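(* Let $r\le t$ and $k$ be positive integers and let $L$ be an $(r,t)$-blownup tree of size $k$. Then there is a constant $C$ depending only on $L$ such that $\mathrm{ex}(n,L)\le C n^{2-\frac{1}{r}}$ for all $n$.
   Context: For a graph $F$, $\mathrm{ex}(n,F)$ denotes the maximum number of edges in a simple graph on $n$ vertices that does not contain $F$ as a subgraph. An $(r,t)$-blownup tree of size $k$ is defined as follows: let $X_1=Y_0,Y_1,\ldots,Y_k$ be pairwise disjoint sets with $|X_1|=r$ and $|Y_1|=\cdots=|Y_k|=t$; for each $2\le i\le k$ let $X_i$ be a subset of size $r$ of some $Y_j$ with $j<i$. The graph with vertex set $Y_0\cup Y_1\cup\cdots\cup Y_k$ and edge set $\bigcup_{1\le i\le k}\{xy: x\in X_i,\ y\in Y_i\}$ is an $(r,t)$-blownup tree of size $k$. *)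

theory Defs
  imports Complex_Main "HOL-Library.Disjoint_Sets" "HOL-Library.Ramsey"
begin

type_synonym 'a graph = "'a set \<times> 'a set set"

abbreviation verts :: "'a graph \<Rightarrow> 'a set" where
  "verts G \<equiv> fst G"

abbreviation edges :: "'a graph \<Rightarrow> 'a set set" where
  "edges G \<equiv> snd G"

text \<open>All graphs are finite; an edge is a two-element set of vertices.\<close>

definition simple_graph :: "'a graph \<Rightarrow> bool" where
  "simple_graph G \<longleftrightarrow> finite (verts G) \<and> edges G \<subseteq> nsets (verts G) 2"

text \<open>Containment as a (not necessarily induced) subgraph, up to isomorphism.\<close>

definition contains_subgraph :: "'b graph \<Rightarrow> 'a graph \<Rightarrow> bool" where
  "contains_subgraph G F \<longleftrightarrow>
     (\<exists>f. inj_on f (verts F) \<and> f ` verts F \<subseteq> verts G \<and> (\<forall>e\<in>edges F. f ` e \<in> edges G))"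

text \<open>
  Host graphs have natural numbers as vertices, which covers every finite graph up to
  isomorphism. The set is finite, and it is nonempty as soon as F has an edge (the edgeless
  graph is then F-free); for edgeless F it can be empty, and then the value is unspecified.
\<close>

definition extremal_number :: "nat \<Rightarrow> 'a graph \<Rightarrow> nat" where
  "extremal_number n F =
     Max {card (edges G) | G :: nat graph.
            simple_graph G \<and> card (verts G) = n \<and> \<not> contains_subgraph G F}"

definition blownup_tree :: "nat \<Rightarrow> nat \<Rightarrow> nat \<Rightarrow> 'a graph \<Rightarrow> bool" where
  "blownup_tree r t k L \<longleftrightarrow>
     (\<exists>X Y :: nat \<Rightarrow> 'a set.
        X 1 = Y 0 \<and>
        disjoint_family_on Y {0..k} \<and>
        finite (X 1) \<and> card (X 1) = r \<and>
        (\<forall>i\<in>{1..k}. finite (Y i) \<and> card (Y i) = t) \<and>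
        (\<forall>i\<in>{2..k}. card (X i) = r \<and> (\<exists>j<i. X i \<subseteq> Y j)) \<and>
        verts L = (\<Union>i\<in>{0..k}. Y i) \<and>
        edges L = (\<Union>i\<in>{1..k}. {{x, y} | x y. x \<in> X i \<and> y \<in> Y i}))"

end

theory Submission
  imports Defs
begin

text \<open>
  Let \<open>d(S)\<close> be the number of common neighbours of an \<open>r\<close>-set \<open>S\<close> of vertices, and weigh \<open>S\<close> by
  \<open>d(S) choose r\<close>, the number of \<open>r\<close>-sets completely joined to \<open>S\<close>. Call \<open>S\<close> bad of level \<open>0\<close> if
  \<open>d(S)\<close> is below a constant, and bad of level \<open>i + 1\<close> if it is bad of level \<open>i\<close> or if, after
  removal of some boundedly many vertices, every \<open>t\<close>-set of common neighbours of \<open>S\<close> contains an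
  \<open>r\<close>-set that is bad of level \<open>i\<close>. In the latter case a positive proportion of the \<open>r\<close>-sets joined
  to \<open>S\<close> is bad of level \<open>i\<close>, so by double counting the total weight grows by at most a constant
  factor per level and is \<open>O(n ^ r)\<close> at level \<open>k\<close>. A graph with many edges has larger total
  weight, hence an \<open>r\<close>-set that is not bad of level \<open>k\<close>. There \<open>Y 0\<close> is placed, and the
  tree is embedded greedily, keeping all \<open>r\<close>-subsets of the image of \<open>Y i\<close> not bad
  of level \<open>k - i\<close>.
\<close>

section \<open>Binomial estimates and a counting bound for hitting families\<close>

lemma choose_le_power: "n choose r \<le> n ^ r"
  by (cases "r \<le> n") (simp_all add: binomial_le_pow binomial_eq_0)

lemma power_le_choose:
  fixes r n :: nat
  assumes "1 \<le> r" "r \<le> n"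
  shows "n ^ r \<le> r ^ r * (n choose r)"
proof -
  have "(real n / real r) ^ r \<le> real (n choose r)"
    using binomial_ge_n_over_k_pow_k[OF assms(2), where 'a = real] .
  then have "real n ^ r \<le> real r ^ r * real (n choose r)"
    using assms by (simp add: power_divide field_simps)
  then show ?thesis
    by (metis of_nat_le_iff of_nat_mult of_nat_power)
qed

text \<open>Allows sums of \<open>d(S)\<close> to be bounded by the weight. From \<open>r\<close>
  on, Pascal's rule adds at least 1 per step; below \<open>r\<close> the summand \<open>r\<close>
  suffices.\<close>

lemma le_choose_add:
  fixes r d :: nat
  assumes "1 \<le> r"
  shows "d \<le> (d choose r) + r"
proof (cases "r \<le> d")
  case True
  then show ?thesis
    using assms
  proof (induction d rule: dec_induct)
    case (step m)
    obtain q where q: "r = Suc q" using assms by (cases r) auto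
    then have "0 < m choose q" using step.hyps by simp
    then have "Suc (m choose r) \<le> Suc m choose r" unfolding q by (simp add: Suc_le_eq)
    then show ?case using step by linarith
  qed simp
qed simp

lemma card_supersets_le:
  assumes "finite A" "R \<in> nsets A r"
  shows "card {T \<in> nsets A t. R \<subseteq> T} \<le> (card A - r) choose (t - r)"
proof -
  have R: "R \<subseteq> A" "finite R" "card R = r" using assms by (auto simp: nsets_def)
  have "inj_on (\<lambda>T. T - R) {T \<in> nsets A t. R \<subseteq> T}"
    by (auto simp: inj_on_def)
  moreover have "(\<lambda>T. T - R) ` {T \<in> nsets A t. R \<subseteq> T} \<subseteq> nsets (A - R) (t - r)"
    using R by (auto simp: nsets_def card_Diff_subset)
  ultimately have "card {T \<in> nsets A t. R \<subseteq> T} \<le> card (nsets (A - R) (t - r))"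
    by (rule card_inj_on_le) (use assms in \<open>auto intro: finite_imp_finite_nsets\<close>)
  also have "\<dots> = (card A - r) choose (t - r)"
    using R assms by (simp add: card_Diff_subset)
  finally show ?thesis .
qed

text \<open>Each member of \<open>B\<close> inside \<open>A\<close> lies in at most
  \<open>(card A - r) choose (t - r)\<close> of the \<open>t\<close>-sets, and these must cover all
  \<open>t\<close>-sets. The identity (d choose t)(t choose r) = (d choose r)(d - r choose t - r)
  then cancels the common factor.\<close>

lemma choose_le_card_hitting_family:
  assumes A: "finite A" and rt: "r \<le> t" "t \<le> card A"
    and hit: "\<And>T. T \<in> nsets A t \<Longrightarrow> \<exists>R\<in>nsets T r. R \<in> B"
  shows "card A choose r \<le> (t choose r) * card (nsets A r \<inter> B)"
proof -
  let ?H = "nsets A r \<inter> B" and ?d = "card A"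
  have fH: "finite ?H" using A by (auto intro: finite_imp_finite_nsets)
  have sub: "nsets A t \<subseteq> (\<Union>R\<in>?H. {T \<in> nsets A t. R \<subseteq> T})"
  proof
    fix T assume T: "T \<in> nsets A t"
    from hit[OF T] obtain R where R: "R \<in> nsets T r" "R \<in> B" by blast
    then have "R \<in> ?H" "R \<subseteq> T" using T by (auto simp: nsets_def)
    then show "T \<in> (\<Union>R\<in>?H. {T \<in> nsets A t. R \<subseteq> T})" using T by blast
  qed
  have "?d choose t = card (nsets A t)" by simp
  also have "\<dots> \<le> card (\<Union>R\<in>?H. {T \<in> nsets A t. R \<subseteq> T})"
    by (rule card_mono[OF _ sub]) (use fH A in \<open>simp add: finite_imp_finite_nsets\<close>)
  also have "\<dots> \<le> (\<Sum>R\<in>?H. card {T \<in> nsets A t. R \<subseteq> T})"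
    by (rule card_UN_le[OF fH])
  also have "\<dots> \<le> (\<Sum>R\<in>?H. (?d - r) choose (t - r))"
    by (rule sum_mono) (use A in \<open>auto intro: card_supersets_le\<close>)
  finally have "?d choose t \<le> card ?H * ((?d - r) choose (t - r))" by simp
  then have "(?d choose t) * (t choose r) \<le> ((t choose r) * card ?H) * ((?d - r) choose (t - r))"
    using mult_le_mono2[of "?d choose t" _ "t choose r"] by (simp add: algebra_simps)
  then have "(?d choose r) * ((?d - r) choose (t - r))
      \<le> ((t choose r) * card ?H) * ((?d - r) choose (t - r))"
    using choose_mult[OF rt] by simp
  moreover have "0 < (?d - r) choose (t - r)" using rt by simp
  ultimately show ?thesis by simp
qed

text \<open>Losing \<open>M\<close> out of at least \<open>2 * (M + t)\<close> elements leaves at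
  least half of them, and at least \<open>r\<close>. Comparing both binomials with powers then costs
  only a constant factor.\<close>

lemma choose_le_choose_diff:
  fixes r M t d :: nat
  assumes "1 \<le> r" "r \<le> t" "2 * (M + t) \<le> d" "d \<le> e + M"
  shows "d choose r \<le> (2 * r) ^ r * (e choose r)"
proof -
  have e: "d \<le> 2 * e" "r \<le> e" using assms by auto
  have "d choose r \<le> d ^ r" by (rule choose_le_power)
  also have "\<dots> \<le> (2 * e) ^ r" using e by (intro power_mono) auto
  also have "\<dots> = 2 ^ r * e ^ r" by (simp add: power_mult_distrib)
  also have "\<dots> \<le> 2 ^ r * (r ^ r * (e choose r))"
    using power_le_choose[OF assms(1) e(2)] by simp
  finally show ?thesis by (simp add: power_mult_distrib mult.assoc)
qed

section \<open>Bad sets and the growth of their weight\<close>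

definition common_nbrs :: "'a graph \<Rightarrow> 'a set \<Rightarrow> 'a set" where
  "common_nbrs G S = {v \<in> verts G. \<forall>u\<in>S. {u, v} \<in> edges G}"

text \<open>\<open>U\<close> stands for the vertices already occupied by a partial embedding,
  \<open>M\<close> for a bound on their number. The threshold \<open>2 * (M + t)\<close> of level 0
  ensures that for any other set at least half of the common neighbours, and at least
  \<open>t\<close>, survive the removal of \<open>U\<close>, so that the condition on
  \<open>T\<close> is not vacuous.\<close>

primrec bad_sets :: "'a graph \<Rightarrow> nat \<Rightarrow> nat \<Rightarrow> nat \<Rightarrow> nat \<Rightarrow> 'a set set" where
  "bad_sets G r t M 0 = {S \<in> nsets (verts G) r. card (common_nbrs G S) < 2 * (M + t)}"
| "bad_sets G r t M (Suc i) = bad_sets G r t M i \<union>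
     {S \<in> nsets (verts G) r. \<exists>U. finite U \<and> card U \<le> M \<and>
        (\<forall>T\<in>nsets (common_nbrs G S - U) t. \<exists>R\<in>nsets T r. R \<in> bad_sets G r t M i)}"

lemma bad_sets_mono: "i \<le> j \<Longrightarrow> bad_sets G r t M i \<subseteq> bad_sets G r t M j"
  by (induction j rule: dec_induct) auto

lemma bad_sets_subset: "bad_sets G r t M i \<subseteq> nsets (verts G) r"
  by (induction i) auto

lemma common_nbrs_subset: "common_nbrs G S \<subseteq> verts G"
  by (auto simp: common_nbrs_def)

lemma subset_common_nbrs_commute:
  assumes "S \<subseteq> verts G" "T \<subseteq> verts G"
  shows "T \<subseteq> common_nbrs G S \<longleftrightarrow> S \<subseteq> common_nbrs G T"
  using assms unfolding common_nbrs_def by (auto simp: subset_iff) (metis insert_commute)+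

text \<open>Both sides count the pairs of \<open>S\<close> in \<open>A\<close> and \<open>T\<close>
  in \<open>B\<close> that are completely joined, a symmetric relation.\<close>

lemma sum_card_nsets_common_nbrs:
  fixes G :: "'a graph"
  assumes fV: "finite (verts G)" and A: "A \<subseteq> nsets (verts G) r" and B: "B \<subseteq> nsets (verts G) s"
  shows "(\<Sum>S\<in>A. card (nsets (common_nbrs G S) s \<inter> B)) =
         (\<Sum>T\<in>B. card (nsets (common_nbrs G T) r \<inter> A))"
proof -
  have fA: "finite A" and fB: "finite B"
    using A B fV finite_imp_finite_nsets finite_subset by metis+
  have "(\<Sum>S\<in>A. card (nsets (common_nbrs G S) s \<inter> B))
      = (\<Sum>S\<in>A. \<Sum>T\<in>{T \<in> B. T \<subseteq> common_nbrs G S}. 1)"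
  proof (intro sum.cong refl)
    fix S
    have "nsets (common_nbrs G S) s \<inter> B = {T \<in> B. T \<subseteq> common_nbrs G S}"
      using B by (auto simp: nsets_def)
    then show "card (nsets (common_nbrs G S) s \<inter> B) = (\<Sum>T\<in>{T \<in> B. T \<subseteq> common_nbrs G S}. 1)"
      by simp
  qed
  also have "\<dots> = (\<Sum>T\<in>B. \<Sum>S\<in>{S \<in> A. T \<subseteq> common_nbrs G S}. 1)"
    by (rule sum.swap_restrict[OF fA fB])
  also have "\<dots> = (\<Sum>T\<in>B. card (nsets (common_nbrs G T) r \<inter> A))"
  proof (intro sum.cong refl)
    fix T assume "T \<in> B"
    then have T: "T \<subseteq> verts G" using B by (auto simp: nsets_def)
    have "{S \<in> A. T \<subseteq> common_nbrs G S} = nsets (common_nbrs G T) r \<inter> A"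
    proof -
      have "S \<subseteq> verts G \<and> finite S \<and> card S = r" if "S \<in> A" for S
        using that A by (auto simp: nsets_def)
      then show ?thesis
        using subset_common_nbrs_commute[OF _ T] by (simp add: nsets_def set_eq_iff) metis
    qed
    then show "(\<Sum>S\<in>{S \<in> A. T \<subseteq> common_nbrs G S}. 1) = card (nsets (common_nbrs G T) r \<inter> A)"
      by simp
  qed
  finally show ?thesis .
qed

definition weight :: "'a graph \<Rightarrow> nat \<Rightarrow> 'a set set \<Rightarrow> nat" where
  "weight G r A = (\<Sum>S\<in>A. card (common_nbrs G S) choose r)"

text \<open>The weight of a newly bad set is at most a constant times the number of old bad sets
  joined to it; double counting these pairs bounds the new weight by the old one.\<close>

lemma weight_bad_sets_Suc:
  assumes fV: "finite (verts G)" and rt: "1 \<le> r" "r \<le> t"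
  shows "weight G r (bad_sets G r t M (Suc i))
       \<le> (1 + (2 * r) ^ r * (t choose r)) * weight G r (bad_sets G r t M i)"
proof -
  let ?B = "bad_sets G r t M i" and ?Q = "(2 * r) ^ r * (t choose r)"
  define A where "A = bad_sets G r t M (Suc i) - ?B"
  have AV: "A \<subseteq> nsets (verts G) r" using bad_sets_subset unfolding A_def by blast
  have fA: "finite A" and fB: "finite ?B"
    using AV bad_sets_subset[of G r t M i] fV finite_imp_finite_nsets finite_subset by metis+
  have fN: "finite (common_nbrs G S)" for S
    using fV common_nbrs_subset finite_subset by metis
  have new: "card (common_nbrs G S) choose r \<le> ?Q * card (nsets (common_nbrs G S) r \<inter> ?B)"
    if "S \<in> A" for S
  proof -
    let ?N = "common_nbrs G S"
    \<comment> \<open>Newly bad sets are not bad of level 0, so at least \<open>t\<close> common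
      neighbours remain outside \<open>U\<close>, as the hitting estimate requires.\<close>
    have "S \<notin> bad_sets G r t M 0" using that bad_sets_mono[of 0 i G r t M] unfolding A_def by blast
    then have big: "2 * (M + t) \<le> card ?N"
      using that AV by auto
    from that obtain U where U: "finite U" "card U \<le> M"
      "\<And>T. T \<in> nsets (?N - U) t \<Longrightarrow> \<exists>R\<in>nsets T r. R \<in> ?B"
      unfolding A_def by auto
    have le: "card ?N \<le> card (?N - U) + M"
      using diff_card_le_card_Diff[OF U(1), of ?N] U(2) by linarith
    have "card ?N choose r \<le> (2 * r) ^ r * (card (?N - U) choose r)"
      by (rule choose_le_choose_diff[OF rt big le])
    also have "card (?N - U) choose r \<le> (t choose r) * card (nsets (?N - U) r \<inter> ?B)"
      using big le fN U(3) rt by (intro choose_le_card_hitting_family) auto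
    also have "card (nsets (?N - U) r \<inter> ?B) \<le> card (nsets ?N r \<inter> ?B)"
      using fB by (intro card_mono) (auto simp: nsets_def)
    finally show ?thesis by (simp add: mult.assoc)
  qed
  have "weight G r A \<le> (\<Sum>S\<in>A. ?Q * card (nsets (common_nbrs G S) r \<inter> ?B))"
    unfolding weight_def by (rule sum_mono) (rule new)
  \<comment> \<open>Each pair is now charged to its old bad set \<open>T\<close>, which is joined to
    at most \<open>card (common_nbrs G T) choose r\<close> sets of size \<open>r\<close>.\<close>
  also have "\<dots> = ?Q * (\<Sum>T\<in>?B. card (nsets (common_nbrs G T) r \<inter> A))"
    unfolding sum_distrib_left[symmetric]
      sum_card_nsets_common_nbrs[OF fV AV bad_sets_subset[of G r t M i]] ..
  also have "\<dots> \<le> ?Q * weight G r ?B"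
    unfolding weight_def
  proof (intro mult_le_mono2 sum_mono)
    fix T
    have "card (nsets (common_nbrs G T) r \<inter> A) \<le> card (nsets (common_nbrs G T) r)"
      by (intro card_mono finite_imp_finite_nsets fN) auto
    then show "card (nsets (common_nbrs G T) r \<inter> A) \<le> card (common_nbrs G T) choose r" by simp
  qed
  finally have "weight G r A \<le> ?Q * weight G r ?B" .
  moreover have "weight G r (bad_sets G r t M (Suc i)) = weight G r ?B + weight G r A"
  proof -
    have "bad_sets G r t M (Suc i) = ?B \<union> A" unfolding A_def by auto
    moreover have "?B \<inter> A = {}" unfolding A_def by blast
    ultimately show ?thesis unfolding weight_def using fA fB by (simp only: sum.union_disjoint)
  qed
  ultimately show ?thesis by simp
qed

text \<open>At level 0 there are at most \<open>card (verts G) ^ r\<close> sets, each of weight at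
  most \<open>(2 * (M + t)) ^ r\<close>; every further level costs one constant factor.\<close>

lemma weight_bad_sets_le:
  assumes fV: "finite (verts G)" and rt: "1 \<le> r" "r \<le> t"
  shows "weight G r (bad_sets G r t M i)
       \<le> (1 + (2 * r) ^ r * (t choose r)) ^ i * (2 * (M + t)) ^ r * card (verts G) ^ r"
proof (induction i)
  case 0
  have "weight G r (bad_sets G r t M 0) \<le> (\<Sum>S\<in>bad_sets G r t M 0. (2 * (M + t)) ^ r)"
    unfolding weight_def
  proof (rule sum_mono)
    fix S assume "S \<in> bad_sets G r t M 0"
    then have "card (common_nbrs G S) \<le> 2 * (M + t)" by simp
    then show "card (common_nbrs G S) choose r \<le> (2 * (M + t)) ^ r"
      using choose_le_power le_trans power_mono by blast
  qed
  also have "\<dots> \<le> card (nsets (verts G) r) * (2 * (M + t)) ^ r"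
    using card_mono[OF finite_imp_finite_nsets[OF fV, of r] bad_sets_subset[of G r t M 0]]
    by simp
  also have "\<dots> \<le> card (verts G) ^ r * (2 * (M + t)) ^ r"
    using choose_le_power by simp
  finally show ?case by (simp add: mult.commute)
next
  case (Suc i)
  let ?Q = "1 + (2 * r) ^ r * (t choose r)"
  have "weight G r (bad_sets G r t M (Suc i)) \<le> ?Q * weight G r (bad_sets G r t M i)"
    by (rule weight_bad_sets_Suc[OF assms])
  also have "\<dots> \<le> ?Q * (?Q ^ i * (2 * (M + t)) ^ r * card (verts G) ^ r)"
    using Suc.IH by (rule mult_le_mono2)
  finally show ?case by (simp only: mult.assoc power_Suc)
qed

section \<open>Lower bound on star counts from the number of edges\<close>

lemma handshake_le:
  assumes "simple_graph G"
  shows "2 * card (edges G) \<le> (\<Sum>v\<in>verts G. card (common_nbrs G {v}))"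
proof -
  have fV: "finite (verts G)" and E: "edges G \<subseteq> nsets (verts G) 2"
    using assms by (auto simp: simple_graph_def)
  have fE: "finite (edges G)" using E fV finite_imp_finite_nsets finite_subset by metis
  have fN: "finite (common_nbrs G S)" for S
    using fV common_nbrs_subset finite_subset by metis
  have "2 * card (edges G) = (\<Sum>e\<in>edges G. \<Sum>v\<in>{v \<in> verts G. v \<in> e}. 1)"
  proof -
    have "(\<Sum>v\<in>{v \<in> verts G. v \<in> e}. 1) = (2::nat)" if "e \<in> edges G" for e
    proof -
      have "e \<subseteq> verts G" "card e = 2" using that E by (auto simp: nsets_def)
      moreover from this have "{v \<in> verts G. v \<in> e} = e" by auto
      ultimately show ?thesis by simp
    qed
    then show ?thesis by simp
  qed
  also have "\<dots> = (\<Sum>v\<in>verts G. \<Sum>e\<in>{e \<in> edges G. v \<in> e}. 1)"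
    by (rule sum.swap_restrict[OF fE fV])
  also have "\<dots> \<le> (\<Sum>v\<in>verts G. card (common_nbrs G {v}))"
  proof (rule sum_mono)
    fix v
    have "{e \<in> edges G. v \<in> e} \<subseteq> (\<lambda>u. {v, u}) ` common_nbrs G {v}"
    proof
      fix e assume "e \<in> {e \<in> edges G. v \<in> e}"
      then have e: "e \<in> edges G" "v \<in> e" "e \<subseteq> verts G" "card e = 2"
        using E by (auto simp: nsets_def)
      then obtain u where "e = {v, u}" by (auto simp: card_2_iff)
      with e show "e \<in> (\<lambda>u. {v, u}) ` common_nbrs G {v}"
        by (auto simp: common_nbrs_def)
    qed
    then show "(\<Sum>e\<in>{e \<in> edges G. v \<in> e}. 1) \<le> card (common_nbrs G {v})"
      using surj_card_le[OF fN] by simp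
  qed
  finally show ?thesis .
qed

text \<open>Stars with \<open>r\<close> leaves, counted by centre and by leaf set: the double count
  above with \<open>s = 1\<close>, single vertices being identified with singletons.\<close>

lemma sum_choose_degree:
  assumes fV: "finite (verts G)"
  shows "(\<Sum>v\<in>verts G. card (common_nbrs G {v}) choose r)
       = (\<Sum>S\<in>nsets (verts G) r. card (common_nbrs G S))"
proof -
  have absorb: "nsets (common_nbrs G S) s \<inter> nsets (verts G) s = nsets (common_nbrs G S) s" for S s
    using common_nbrs_subset[of G S] by (auto simp: nsets_def)
  have "(\<Sum>S\<in>nsets (verts G) r. card (nsets (common_nbrs G S) 1 \<inter> nsets (verts G) 1))
      = (\<Sum>T\<in>nsets (verts G) 1. card (nsets (common_nbrs G T) r \<inter> nsets (verts G) r))"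
    by (rule sum_card_nsets_common_nbrs[OF fV order_refl order_refl])
  then have "(\<Sum>S\<in>nsets (verts G) r. card (common_nbrs G S))
      = (\<Sum>T\<in>nsets (verts G) 1. card (common_nbrs G T) choose r)"
    by (simp add: absorb)
  also have "nsets (verts G) 1 = (\<lambda>v. {v}) ` verts G"
    by (auto simp: nsets_def card_1_singleton_iff)
  finally show ?thesis by (simp add: sum.reindex)
qed

text \<open>The added 1 covers \<open>x < r\<close>, where the binomial vanishes.\<close>

lemma power_le_choose_Suc:
  fixes r x :: nat
  assumes "1 \<le> r"
  shows "x ^ r \<le> r ^ r * ((x choose r) + 1)"
proof (cases "r \<le> x")
  case True
  then show ?thesis using power_le_choose[OF assms True] by (simp add: algebra_simps)
next
  case False
  then have "x ^ r \<le> r ^ r" by (intro power_mono) auto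
  then show ?thesis by (simp add: algebra_simps)
qed

text \<open>A convexity argument: the edge bound forces the sum of the \<open>r\<close>-th powers of
  the degrees above \<open>(r * K) ^ r * n ^ r\<close>. Passing to binomials costs the factor
  \<open>r ^ r\<close> and an additive \<open>n\<close>, which is at most
  \<open>n ^ r\<close>.\<close>

lemma sum_choose_degree_gt:
  fixes G :: "'a graph" and K r :: nat
  assumes G: "simple_graph G" and r: "1 \<le> r" and K: "1 \<le> K"
    and many: "real r * real K * real (card (verts G)) powr (2 - 1 / real r) < real (card (edges G))"
  shows "K * card (verts G) ^ r
       < (\<Sum>v\<in>verts G. card (common_nbrs G {v}) choose r) + card (verts G) ^ r"
proof -
  define n where "n = card (verts G)"
  define x where "x v = card (common_nbrs G {v})" for v
  \<comment> \<open>Chosen so that \<open>a * n\<close> is the assumed edge bound, whence the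
    average degree exceeds \<open>2 * a\<close>, while \<open>n * a ^ r\<close> is exactly
    \<open>(r * K) ^ r * n ^ r\<close>.\<close>
  define a where "a = real r * real K * real n powr (1 - 1 / real r)"
  have fV: "finite (verts G)" and E: "edges G \<subseteq> nsets (verts G) 2"
    using G by (auto simp: simple_graph_def)
  have "n \<noteq> 0"
  proof
    assume "n = 0"
    then have "verts G = {}" using fV n_def by simp
    then have "edges G = {}" using E by (auto simp: nsets_def)
    then show False using many \<open>n = 0\<close> by (simp add: n_def)
  qed
  then have n: "1 \<le> n" by simp
  have a0: "0 < a" using n r K unfolding a_def by simp
  have an: "a * real n = real r * real K * real n powr (2 - 1 / real r)"
  proof -
    have "real n powr (2 - 1 / real r) = real n powr (1 - 1 / real r) * real n powr 1"
      unfolding powr_add[symmetric] by simp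
    then show ?thesis unfolding a_def using n by simp
  qed
  have ar: "real n * a ^ r = real ((r * K) ^ r * n ^ r)"
  proof -
    have "(real n powr (1 - 1 / real r)) ^ r = real n powr (real r - 1)"
      using n r by (simp add: powr_power algebra_simps)
    also have "\<dots> = real n ^ (r - 1)"
      using n r powr_realpow[of "real n" "r - 1"] by (simp add: of_nat_diff)
    finally have "real n * (real n powr (1 - 1 / real r)) ^ r = real n ^ r"
      using r by (cases r) auto
    then show ?thesis
      unfolding a_def by (simp add: power_mult_distrib mult.left_commute)
  qed
  \<comment> \<open>A pointwise substitute for Jensen's inequality: degrees up to \<open>a\<close>
    are absorbed by \<open>a ^ r\<close>, larger ones by their own power.\<close>
  have pow: "real (x v) * a ^ (r - 1) \<le> real (x v) ^ r + a ^ r" for v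
  proof (cases "real (x v) \<le> a")
    case True
    then have "real (x v) * a ^ (r - 1) \<le> a * a ^ (r - 1)" using a0 by (intro mult_right_mono) auto
    also have "\<dots> = a ^ r" using r by (cases r) auto
    finally show ?thesis by (simp add: add_increasing)
  next
    case False
    then have "real (x v) * a ^ (r - 1) \<le> real (x v) * real (x v) ^ (r - 1)"
      using a0 by (intro mult_left_mono power_mono) auto
    also have "\<dots> = real (x v) ^ r" using r by (cases r) auto
    finally show ?thesis using a0 by (simp add: add_increasing2)
  qed
  \<comment> \<open>The handshake factor 2 pays for the cutoff: of \<open>2 * (n * a ^ r)\<close>,
    one half is lost to the added terms \<open>a ^ r\<close> in \<open>pow\<close> and the other
    remains.\<close>
  have "2 * (a * real n) < real (2 * card (edges G))"
    using many an n_def by simp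
  also have "\<dots> \<le> real (\<Sum>v\<in>verts G. x v)"
    using handshake_le[OF G] unfolding x_def of_nat_le_iff .
  finally have "2 * (a * real n) * a ^ (r - 1) < (\<Sum>v\<in>verts G. real (x v)) * a ^ (r - 1)"
    using a0 by (intro mult_strict_right_mono) auto
  also have "\<dots> \<le> (\<Sum>v\<in>verts G. real (x v) ^ r + a ^ r)"
    unfolding sum_distrib_right by (rule sum_mono) (rule pow)
  also have "\<dots> = (\<Sum>v\<in>verts G. real (x v) ^ r) + real n * a ^ r"
    by (simp add: sum.distrib n_def)
  also have "2 * (a * real n) * a ^ (r - 1) = 2 * (real n * a ^ r)"
    using r by (cases r) auto
  finally have "real ((r * K) ^ r * n ^ r) < real (\<Sum>v\<in>verts G. x v ^ r)"
    using ar by (simp add: mult.commute)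
  then have "(r * K) ^ r * n ^ r < (\<Sum>v\<in>verts G. x v ^ r)"
    by (simp only: of_nat_less_iff)
  also have "\<dots> \<le> (\<Sum>v\<in>verts G. r ^ r * ((x v choose r) + 1))"
    by (rule sum_mono) (rule power_le_choose_Suc[OF r])
  also have "\<dots> = r ^ r * ((\<Sum>v\<in>verts G. x v choose r) + n)"
    by (simp add: sum_distrib_left[symmetric] sum.distrib n_def distrib_left mult.commute)
  \<comment> \<open>The factor \<open>r\<close> in \<open>a\<close> was put there to cancel this
    \<open>r ^ r\<close>.\<close>
  finally have "r ^ r * (K ^ r * n ^ r) < r ^ r * ((\<Sum>v\<in>verts G. x v choose r) + n)"
    by (simp add: power_mult_distrib mult.assoc)
  then have "K ^ r * n ^ r < (\<Sum>v\<in>verts G. x v choose r) + n"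
    by simp
  moreover have "K * n ^ r \<le> K ^ r * n ^ r"
    using self_le_power[of K r] K r by simp
  moreover have "n \<le> n ^ r"
    using self_le_power[of n r] n r by simp
  ultimately show ?thesis unfolding n_def x_def by linarith
qed

text \<open>If all \<open>r\<close>-sets were bad, the weight bound would limit the star count. The
  three summands of \<open>K\<close> pay for the weight, for the error \<open>r\<close> per set in
  \<open>le_choose_add\<close>, and for the extra \<open>n ^ r\<close> in
  \<open>sum_choose_degree_gt\<close>.\<close>

lemma ex_not_bad_set:
  fixes G :: "'a graph"
  assumes G: "simple_graph G" and rt: "1 \<le> r" "r \<le> t"
    and K: "K = (1 + (2 * r) ^ r * (t choose r)) ^ k * (2 * (M + t)) ^ r + r + 1"
    and many: "real r * real K * real (card (verts G)) powr (2 - 1 / real r) < real (card (edges G))"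
  shows "\<exists>S \<in> nsets (verts G) r. S \<notin> bad_sets G r t M k"
proof (rule ccontr)
  assume "\<not> ?thesis"
  then have eq: "bad_sets G r t M k = nsets (verts G) r"
    using bad_sets_subset[of G r t M k] by blast
  let ?n = "card (verts G)"
  have fV: "finite (verts G)" using G by (simp add: simple_graph_def)
  have "(\<Sum>v\<in>verts G. card (common_nbrs G {v}) choose r)
      = (\<Sum>S\<in>nsets (verts G) r. card (common_nbrs G S))"
    by (rule sum_choose_degree[OF fV])
  also have "\<dots> \<le> (\<Sum>S\<in>nsets (verts G) r. (card (common_nbrs G S) choose r) + r)"
    by (rule sum_mono) (rule le_choose_add[OF rt(1)])
  also have "\<dots> = weight G r (bad_sets G r t M k) + r * (?n choose r)"
    by (simp add: sum.distrib weight_def eq)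
  also have "\<dots> \<le> (1 + (2 * r) ^ r * (t choose r)) ^ k * (2 * (M + t)) ^ r * ?n ^ r + r * ?n ^ r"
    by (intro add_mono mult_le_mono2 weight_bad_sets_le[OF fV rt] choose_le_power)
  finally have "(\<Sum>v\<in>verts G. card (common_nbrs G {v}) choose r) + ?n ^ r \<le> K * ?n ^ r"
    unfolding K by (simp add: algebra_simps)
  moreover have "1 \<le> K" unfolding K by simp
  ultimately show False
    using sum_choose_degree_gt[OF G rt(1) _ many] by simp
qed

section \<open>Greedy embedding of the tree\<close>

text \<open>Every \<open>r\<close>-subset of an embedded \<open>Y j\<close> may later serve as an
  \<open>X l\<close>, so \<open>good\<close> demands that all of their images retain enough quality
  for the remaining \<open>k - j\<close> steps.\<close>

lemma extend_embedding:
  fixes X Y :: "nat \<Rightarrow> 'a set" and G :: "'b graph" and r t k M i :: nat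
  defines "W \<equiv> \<lambda>i. \<Union>j\<in>{0..i}. Y j"
  defines "good \<equiv> \<lambda>f i. inj_on f (W i) \<and> f ` W i \<subseteq> verts G \<and>
      (\<forall>l\<in>{1..i}. \<forall>x\<in>X l. \<forall>y\<in>Y l. {f x, f y} \<in> edges G) \<and>
      (\<forall>j\<le>i. \<forall>S\<in>nsets (Y j) r. f ` S \<notin> bad_sets G r t M (k - j))"
  assumes fV: "finite (verts G)"
    and disj: "disjoint_family_on Y {0..k}"
    and Y: "finite (Y (Suc i))" "card (Y (Suc i)) = t"
    and X: "finite (X (Suc i))" "card (X (Suc i)) = r" "j < Suc i" "X (Suc i) \<subseteq> Y j"
    and XW: "\<forall>l\<in>{1..i}. X l \<subseteq> W i"
    and W: "finite (W i)" "card (W i) \<le> M"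
    and ik: "Suc i \<le> k"
    and f: "good f i"
  shows "\<exists>g. good g (Suc i)"
proof -
  let ?S = "f ` X (Suc i)"
  have XWi: "X (Suc i) \<subseteq> W i" using X unfolding W_def by force
  have YW: "Y l \<subseteq> W i" if "l \<le> i" for l using that unfolding W_def by auto
  have new: "Y (Suc i) \<inter> W i = {}"
  proof -
    have "Y (Suc i) \<inter> Y l = {}" if "l \<le> i" for l
      using disj that ik by (intro disjoint_family_onD) auto
    then show ?thesis unfolding W_def by fastforce
  qed
  have W_Suc: "W (Suc i) = W i \<union> Y (Suc i)"
    unfolding W_def by (auto simp: le_Suc_eq)
  have inj: "inj_on f (W i)" and fWV: "f ` W i \<subseteq> verts G"
    and fE: "\<And>l x y. l \<in> {1..i} \<Longrightarrow> x \<in> X l \<Longrightarrow> y \<in> Y l \<Longrightarrow> {f x, f y} \<in> edges G"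
    and fbad: "\<And>l S. l \<le> i \<Longrightarrow> S \<in> nsets (Y l) r \<Longrightarrow> f ` S \<notin> bad_sets G r t M (k - l)"
    using f unfolding good_def by blast+
  have S: "?S \<in> nsets (verts G) r"
    using X XWi fWV card_image[OF inj_on_subset[OF inj XWi]] by (auto simp: nsets_def)
  have "?S \<notin> bad_sets G r t M (k - j)"
    using X by (intro fbad) (auto simp: nsets_def)
  \<comment> \<open>As \<open>j \<le> i\<close>, the level \<open>k - j\<close> is at least
    \<open>k - i\<close>, one above the level required of the new set; badness is monotone in the
    level.\<close>
  moreover have "Suc (k - Suc i) \<le> k - j" using X ik by simp
  ultimately have "?S \<notin> bad_sets G r t M (Suc (k - Suc i))"
    using bad_sets_mono by blast
  then have "\<exists>T\<in>nsets (common_nbrs G ?S - f ` W i) t.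
      \<forall>R\<in>nsets T r. R \<notin> bad_sets G r t M (k - Suc i)"
    using S W card_image_le[OF W(1), of f] le_trans by fastforce
  then obtain T where T: "T \<subseteq> common_nbrs G ?S - f ` W i" "finite T" "card T = t"
    and Tgood: "\<And>R. R \<in> nsets T r \<Longrightarrow> R \<notin> bad_sets G r t M (k - Suc i)"
    by (auto simp: nsets_def)
  obtain h where h: "bij_betw h (Y (Suc i)) T"
    using finite_same_card_bij[OF Y(1) T(2)] Y T by auto
  define g where "g x = (if x \<in> W i then f x else h x)" for x
  have gW: "g x = f x" if "x \<in> W i" for x using that by (simp add: g_def)
  have gY: "g x = h x" if "x \<in> Y (Suc i)" for x using that new by (auto simp: g_def)
  have gW_im: "g ` A = f ` A" if "A \<subseteq> W i" for A using that gW by (auto simp: image_iff subset_iff)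
  have gY_im: "g ` A = h ` A" if "A \<subseteq> Y (Suc i)" for A
    using that gY by (intro image_cong) auto
  have hT: "h ` Y (Suc i) = T" "inj_on h (Y (Suc i))" using h by (auto simp: bij_betw_def)
  have injY: "inj_on g (Y (Suc i))" using hT(2) gY by (simp add: inj_on_def)
  have "inj_on g (W (Suc i))"
  proof -
    have "inj_on g (W i)" using inj gW by (simp add: inj_on_def)
    moreover have "g ` W i \<inter> g ` Y (Suc i) = {}"
      using gW_im[of "W i"] gY_im[of "Y (Suc i)"] hT T by auto
    ultimately show ?thesis
      using injY unfolding W_Suc inj_on_Un by blast
  qed
  moreover have "g ` W (Suc i) \<subseteq> verts G"
  proof -
    have "g ` W (Suc i) = f ` W i \<union> T"
      using gW_im[of "W i"] gY_im[of "Y (Suc i)"] hT by (simp add: W_Suc image_Un)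
    moreover have "T \<subseteq> verts G" using T common_nbrs_subset[of G ?S] by blast
    ultimately show ?thesis using fWV by simp
  qed
  moreover have "{g x, g y} \<in> edges G" if l: "l \<in> {1..Suc i}" "x \<in> X l" "y \<in> Y l" for l x y
  proof (cases "l = Suc i")
    case True
    then have "g y \<in> common_nbrs G ?S" using l gY hT T by auto
    moreover have "g x \<in> ?S" using True l XWi gW by auto
    ultimately show ?thesis by (auto simp: common_nbrs_def)
  next
    case False
    then have "l \<in> {1..i}" using l by auto
    moreover from this have "x \<in> W i" "y \<in> W i" using l XW YW[of l] by auto
    ultimately show ?thesis using l fE gW by simp
  qed
  moreover have "g ` S \<notin> bad_sets G r t M (k - l)"
    if l: "l \<le> Suc i" "S \<in> nsets (Y l) r" for l S
  proof (cases "l = Suc i")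
    case True
    then have "S \<subseteq> Y (Suc i)" "finite S" "card S = r" using l by (auto simp: nsets_def)
    then have "g ` S \<in> nsets T r"
      using card_image[OF inj_on_subset[OF injY, of S]] gY_im[of "Y (Suc i)"] hT
      by (auto simp: nsets_def)
    then show ?thesis using Tgood True by blast
  next
    case False
    then have "l \<le> i" using l by auto
    moreover from this have "g ` S = f ` S" using l YW[of l] by (intro gW_im) (auto simp: nsets_def)
    ultimately show ?thesis using l fbad by simp
  qed
  ultimately show ?thesis unfolding good_def by blast
qed

lemma contains_blownup_tree:
  fixes L :: "'a graph" and G :: "'b graph"
  assumes fV: "finite (verts G)" and L: "blownup_tree r t k L"
    and M: "card (verts L) \<le> M"
    and S: "S \<in> nsets (verts G) r" "S \<notin> bad_sets G r t M k"
  shows "contains_subgraph G L"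
proof -
  from L obtain X Y :: "nat \<Rightarrow> 'a set" where
    X1: "X 1 = Y 0" "finite (X 1)" "card (X 1) = r"
    and disj: "disjoint_family_on Y {0..k}"
    and Y: "\<forall>i\<in>{1..k}. finite (Y i) \<and> card (Y i) = t"
    and X: "\<forall>i\<in>{2..k}. card (X i) = r \<and> (\<exists>j<i. X i \<subseteq> Y j)"
    and vL: "verts L = (\<Union>i\<in>{0..k}. Y i)"
    and eL: "edges L = (\<Union>i\<in>{1..k}. {{x, y} | x y. x \<in> X i \<and> y \<in> Y i})"
    unfolding blownup_tree_def by auto
  define W where "W i = (\<Union>j\<in>{0..i}. Y j)" for i
  have fY: "finite (Y i)" if "i \<le> k" for i
    using that X1 Y by (cases "i = 0") auto
  have fW: "finite (W i)" if "i \<le> k" for i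
    using that fY unfolding W_def by auto
  have WM: "card (W i) \<le> M" if "i \<le> k" for i
  proof -
    have "card (W i) \<le> card (W k)" using that by (intro card_mono fW) (fastforce simp: W_def)+
    then show ?thesis using M vL by (simp add: W_def)
  qed
  \<comment> \<open>Since \<open>X 1 = Y 0\<close>, the index 1 fits the general pattern with
    \<open>j = 0\<close>, and the induction can start from \<open>Y 0\<close> alone.\<close>
  have Xj: "card (X i) = r \<and> (\<exists>j<i. X i \<subseteq> Y j)" if "i \<in> {1..k}" for i
    using that X X1 by (cases "i = 1") auto
  have XW: "X l \<subseteq> W i" if l: "l \<in> {1..k}" "l \<le> Suc i" for l i
  proof -
    from Xj[OF l(1)] obtain j where "j < l" "X l \<subseteq> Y j" by blast
    then show ?thesis using l(2) unfolding W_def by force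
  qed
  let ?good = "\<lambda>f i. inj_on f (W i) \<and> f ` W i \<subseteq> verts G \<and>
      (\<forall>l\<in>{1..i}. \<forall>x\<in>X l. \<forall>y\<in>Y l. {f x, f y} \<in> edges G) \<and>
      (\<forall>j\<le>i. \<forall>S\<in>nsets (Y j) r. f ` S \<notin> bad_sets G r t M (k - j))"
  have "i \<le> k \<Longrightarrow> \<exists>f. ?good f i" for i
  proof (induction i)
    case 0
    have SV: "S \<subseteq> verts G" "finite S" "card S = r" using S by (auto simp: nsets_def)
    obtain h where h: "bij_betw h (Y 0) S"
      using finite_same_card_bij[of "Y 0" S] SV X1 by auto
    have "h ` R \<notin> bad_sets G r t M k" if "R \<in> nsets (Y 0) r" for R
    proof -
      \<comment> \<open>\<open>Y 0\<close> has exactly \<open>r\<close> elements, so its only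
        \<open>r\<close>-subset is mapped onto \<open>S\<close>, whose level \<open>k\<close> is the
        one demanded at \<open>j = 0\<close>.\<close>
      have "R = Y 0" using that X1 card_subset_eq[of "Y 0" R] by (auto simp: nsets_def)
      then show ?thesis using h S by (simp add: bij_betw_def)
    qed
    then have "?good h 0" using h SV by (auto simp: bij_betw_def W_def)
    then show ?case by blast
  next
    case (Suc i)
    then obtain f where f: "?good f i" by auto
    have i: "Suc i \<in> {1..k}" using Suc.prems by auto
    from Xj[OF i] obtain j where j: "j < Suc i" "X (Suc i) \<subseteq> Y j" "card (X (Suc i)) = r" by blast
    have fX: "finite (X (Suc i))" using j Suc.prems fY[of j] finite_subset by simp
    have XWi: "\<forall>l\<in>{1..i}. X l \<subseteq> (\<Union>j\<in>{0..i}. Y j)"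
      using XW[of _ i] Suc.prems unfolding W_def by auto
    show ?case
      unfolding W_def
      by (rule extend_embedding[OF fV disj _ _ fX j(3,1,2) XWi _ _ Suc.prems])
        (use bspec[OF Y i] fW[of i] WM[of i] Suc.prems f in \<open>auto simp: W_def\<close>)
  qed
  from this[OF order_refl] obtain f where f: "?good f k" by blast
  have "f ` e \<in> edges G" if e: "e \<in> edges L" for e
  proof -
    from e obtain i x y where "i \<in> {1..k}" "x \<in> X i" "y \<in> Y i" "e = {x, y}"
      unfolding eL by blast
    with f show ?thesis by simp
  qed
  then show ?thesis
    using f unfolding contains_subgraph_def vL W_def by blast
qed

section \<open>The extremal number as an attained maximum, and the final bound\<close>

lemma blownup_tree_has_edge:
  assumes "1 \<le> r" "1 \<le> t" "1 \<le> k" "blownup_tree r t k L"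
  shows "edges L \<noteq> {}"
proof -
  from assms(4) obtain X Y :: "nat \<Rightarrow> 'a set" where
    XY: "card (X 1) = r" "\<forall>i\<in>{1..k}. finite (Y i) \<and> card (Y i) = t"
    and eL: "edges L = (\<Union>i\<in>{1..k}. {{x, y} | x y. x \<in> X i \<and> y \<in> Y i})"
    unfolding blownup_tree_def by auto
  have "X 1 \<noteq> {}" "Y 1 \<noteq> {}" using XY assms by (auto dest!: bspec[of _ _ 1])
  then obtain x y where "x \<in> X 1" "y \<in> Y 1" by blast
  then have "{x, y} \<in> edges L" unfolding eL using assms(3) by force
  then show ?thesis by blast
qed

text \<open>The edgeless graph avoids \<open>F\<close>, and edge counts are at most
  \<open>n choose 2\<close>, so \<open>Max\<close> is taken over a finite nonempty set and belongs
  to it.\<close>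

lemma extremal_number_attained:
  assumes "edges F \<noteq> {}"
  obtains G :: "nat graph" where "simple_graph G" "card (verts G) = n"
    "\<not> contains_subgraph G F" "extremal_number n F = card (edges G)"
proof -
  let ?A = "{card (edges G) | G :: nat graph.
      simple_graph G \<and> card (verts G) = n \<and> \<not> contains_subgraph G F}"
  have "?A \<subseteq> {..n choose 2}"
  proof
    fix m assume "m \<in> ?A"
    then obtain G :: "nat graph" where G: "m = card (edges G)" "simple_graph G" "card (verts G) = n"
      by blast
    then have "m \<le> card (nsets (verts G) 2)"
      by (auto simp: simple_graph_def simp del: card_nsets intro!: card_mono finite_imp_finite_nsets)
    then show "m \<in> {..n choose 2}" using G by simp
  qed
  then have "finite ?A" using finite_subset by blast
  moreover have "0 \<in> ?A"
  proof -
    have "simple_graph ({..<n}, {})" "card (verts ({..<n}, {})) = n"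
      "\<not> contains_subgraph ({..<n}, {}) F"
      using assms by (auto simp: simple_graph_def contains_subgraph_def)
    then show ?thesis by force
  qed
  ultimately have "extremal_number n F \<in> ?A"
    unfolding extremal_number_def by (intro Max_in) auto
  then show ?thesis using that by blast
qed

theorem theorem1p9:
  fixes r t k :: nat and L :: "'a graph"
  assumes "1 \<le> r" and "r \<le> t" and "1 \<le> k"
    and "blownup_tree r t k L"
  shows "\<exists>C :: real. \<forall>n :: nat.
           real (extremal_number n L) \<le> C * real n powr (2 - 1 / real r)"
proof -
  \<comment> \<open>No partial embedding occupies more vertices than the tree has, so this
    \<open>M\<close> bounds every forbidden set \<open>U\<close>. Neither \<open>M\<close> nor
    \<open>K\<close> depends on \<open>n\<close>.\<close>
  define M where "M = card (verts L)"
  define K where "K = (1 + (2 * r) ^ r * (t choose r)) ^ k * (2 * (M + t)) ^ r + r + 1"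
  have "real (extremal_number n L) \<le> real r * real K * real n powr (2 - 1 / real r)" for n
  proof (rule ccontr)
    assume less: "\<not> ?thesis"
    have "edges L \<noteq> {}"
      using assms by (intro blownup_tree_has_edge[of r t k]) auto
    then obtain G :: "nat graph" where G: "simple_graph G" "card (verts G) = n"
      "\<not> contains_subgraph G L" "extremal_number n L = card (edges G)"
      by (rule extremal_number_attained)
    then obtain S where "S \<in> nsets (verts G) r" "S \<notin> bad_sets G r t M k"
      using ex_not_bad_set[OF G(1) assms(1,2) K_def] less by auto
    then have "contains_subgraph G L"
      using contains_blownup_tree[OF _ assms(4), of G M S] G(1)
      by (simp add: M_def simple_graph_def)
    then show False using G(3) by contradiction
  qed
  then show ?thesis by blast
qed

end
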